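(* Let $P=\mathbb{S}^2\setminus\{\mathrm{pt}\}$ be the punctured round sphere, modelled as the complex plane $\mathbb{C}$ with the Riemannian metric $ds^2=\frac{4}{(1+(x^2+y^2))^2}(dx^2+dy^2)$, $z=x+iy$, of constant curvature $+1$, and equip $P\times\mathbb{R}$ with the product metric. Let the functions $f,g:P\to\mathbb{C}$ be holomorphic on the punctured sphere, and let $p:\mathbb{R}\to\mathbb{R}$ be a polynomial $p(t)=b_0+b_1t+b_2t^2+b_3t^3$ such that $(b_2,b_3)\neq 0$. Then the function $$F(z,\bar z,t)=(f(z)+g(\bar z))\cdot p(t)$$ is proper biharmonic on the product space $P\times\mathbb{R}$.
   Context: For a Riemannian manifold $(M,g)$, $\tau=\operatorname{div}\nabla$ denotes the Laplace-Beltrami operator acting on smooth complex-valued functions (the metric being extended complex-bilinearly), and $\tau^2(f)=\tau(\tau(f))$. A function $f:(M,g)\to\mathbb{C}$ is proper biharmonic if $\tau^2(f)=0$ and $\tau(f)$ does not vanish identically. Holomorphic functions on $P$ are entire functions on the model $\mathbb{C}$.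
   Formalization: It is additionally assumed that f(z)+g(z̄) is not identically zero; otherwise (e.g. f = c, g = −c constant) F is identically 0, so τ(F) vanishes and F is not proper biharmonic. *)

theory Defs
  imports "HOL-Complex_Analysis.Complex_Analysis"
begin

text \<open>
  Every manifold considered here has a global chart, so it is modelled on a whole Euclidean
  space \<open>'a\<close>, whose standard basis gives the coordinate frame. The value \<open>G x u v\<close> is the metric
  at the point \<open>x\<close> applied to the tangent vectors \<open>u\<close> and \<open>v\<close>.
\<close>

type_synonym 'a metric_field = "'a \<Rightarrow> 'a \<Rightarrow> 'a \<Rightarrow> real"

text \<open>
  A complex tangent vector is the function assigning to each coordinate vector \<open>i \<in> Basis\<close> its
  complex component; off \<open>Basis\<close> it is 0, so that it is determined by its components.
\<close>

type_synonym 'a complex_vector = "'a \<Rightarrow> complex"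

definition complex_metric ::
    "'a::euclidean_space metric_field \<Rightarrow> 'a \<Rightarrow> 'a complex_vector \<Rightarrow> 'a complex_vector \<Rightarrow> complex" where
  "complex_metric G x X Y = (\<Sum>i\<in>Basis. \<Sum>j\<in>Basis. X i * Y j * of_real (G x i j))"

definition real_vector :: "'a::euclidean_space \<Rightarrow> 'a complex_vector" where
  "real_vector v = (\<lambda>i. if i \<in> Basis then of_real (v \<bullet> i) else 0)"

text \<open>The gradient is characterised by \<open>G(\<nabla>f, v) = df(v)\<close>.\<close>

definition gradient ::
    "'a::euclidean_space metric_field \<Rightarrow> ('a \<Rightarrow> complex) \<Rightarrow> 'a \<Rightarrow> 'a complex_vector" where
  "gradient G f x =
    (THE X. (\<forall>i. i \<notin> Basis \<longrightarrow> X i = 0) \<and>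
            (\<forall>v. complex_metric G x X (real_vector v) = frechet_derivative f (at x) v))"

text \<open>
  The determinant of the matrix \<open>(G x i j)\<close>, by the Leibniz formula: \<^const>\<open>det\<close> is only available
  for matrices indexed by a type.
\<close>

definition gram_det :: "'a::euclidean_space metric_field \<Rightarrow> 'a \<Rightarrow> real" where
  "gram_det G x = (\<Sum>p | p permutes Basis. of_int (sign p) * (\<Prod>i\<in>Basis. G x i (p i)))"

text \<open>\<open>div X = |G|\<^sup>-\<^sup>1\<^sup>/\<^sup>2 \<Sum>\<^sub>i \<partial>\<^sub>i (|G|\<^sup>1\<^sup>/\<^sup>2 X\<^sub>i)\<close>, the divergence in coordinates.\<close>

definition divergence ::
    "'a::euclidean_space metric_field \<Rightarrow> ('a \<Rightarrow> 'a complex_vector) \<Rightarrow> 'a \<Rightarrow> complex" where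
  "divergence G X x =
    (\<Sum>i\<in>Basis. frechet_derivative (\<lambda>y. of_real (sqrt (gram_det G y)) * X y i) (at x) i)
      / of_real (sqrt (gram_det G x))"

definition laplace_beltrami ::
    "'a::euclidean_space metric_field \<Rightarrow> ('a \<Rightarrow> complex) \<Rightarrow> 'a \<Rightarrow> complex" where
  "laplace_beltrami G f = divergence G (gradient G f)"

primrec cont_diff :: "nat \<Rightarrow> ('a::euclidean_space \<Rightarrow> complex) \<Rightarrow> bool" where
  "cont_diff 0 f \<longleftrightarrow> continuous_on UNIV f"
| "cont_diff (Suc k) f \<longleftrightarrow>
    f differentiable_on UNIV \<and> (\<forall>i\<in>Basis. cont_diff k (\<lambda>x. frechet_derivative f (at x) i))"

definition smooth :: "('a::euclidean_space \<Rightarrow> complex) \<Rightarrow> bool" where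
  "smooth f \<longleftrightarrow> (\<forall>k. cont_diff k f)"

definition proper_biharmonic :: "'a::euclidean_space metric_field \<Rightarrow> ('a \<Rightarrow> complex) \<Rightarrow> bool" where
  "proper_biharmonic G f \<longleftrightarrow>
    smooth f \<and>
    (\<forall>x. laplace_beltrami G (laplace_beltrami G f) x = 0) \<and>
    (\<exists>x. laplace_beltrami G f x \<noteq> 0)"

text \<open>The once-punctured unit sphere in the stereographic coordinate \<open>z = x + iy\<close>.\<close>

definition punctured_sphere_metric :: "complex metric_field" where
  "punctured_sphere_metric z u v =
    4 / (1 + ((Re z)\<^sup>2 + (Im z)\<^sup>2))\<^sup>2 * (Re u * Re v + Im u * Im v)"

definition line_metric :: "real metric_field" where
  "line_metric t u v = u * v"

definition product_metric :: "'a metric_field \<Rightarrow> 'b metric_field \<Rightarrow> ('a \<times> 'b) metric_field" where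
  "product_metric G H x u v = G (fst x) (fst u) (fst v) + H (snd x) (snd u) (snd v)"

end

theory Submission
  imports Defs
begin

text \<open>
  In the stereographic coordinate the metric is conformally flat with factor
  \<open>c(z) = 4 / (1 + |z|\<^sup>2)\<^sup>2\<close>, so that of the product is diagonal with entries \<open>c, c, 1\<close> and
  volume density \<open>c\<close>. Hence the density cancels against the inverse metric in the two sphere
  directions, while in the line direction it is constant and can be pulled out:
  \<open>\<tau>(F) = c\<^sup>-\<^sup>1 (F\<^sub>x\<^sub>x + F\<^sub>y\<^sub>y) + F\<^sub>t\<^sub>t\<close>. A function \<open>f(z) + g(cnj z)\<close> is killed by the flat Laplacian,
  and therefore \<open>\<tau>\<close> acts on \<open>(f(z) + g(cnj z)) q(t)\<close> just as \<open>q \<mapsto> q''\<close>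
  (\<open>laplace_beltrami_separated\<close>). For a cubic \<open>q\<close> the fourth derivative vanishes, and the second
  derivative \<open>2 b\<^sub>2 + 6 b\<^sub>3 t\<close> is not the zero polynomial unless \<open>b\<^sub>2 = b\<^sub>3 = 0\<close>.

  The functions \<open>(f(z) + g(cnj z)) q(t)\<close>, with \<open>f\<close>, \<open>g\<close> entire and \<open>q\<close> a polynomial, form a
  family closed under the coordinate derivatives. This gives their smoothness, and it turns the
  computation of \<open>\<tau>\<close> into repeated use of one derivative formula,
  \<open>frechet_derivative_separated\<close>.
\<close>

section \<open>Gradient and volume density of a diagonal metric\<close>

lemma complex_metric_real_vector_diagonal:
  fixes G :: "'a::euclidean_space metric_field"
  assumes diag: "\<forall>i\<in>Basis. \<forall>j\<in>Basis. i \<noteq> j \<longrightarrow> G x i j = 0"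
  shows "complex_metric G x X (real_vector v) =
    (\<Sum>i\<in>Basis. X i * of_real (v \<bullet> i) * of_real (G x i i))"
proof -
  have "(\<Sum>j\<in>Basis. X i * real_vector v j * of_real (G x i j)) =
      X i * of_real (v \<bullet> i) * of_real (G x i i)" if i: "i \<in> Basis" for i
  proof -
    have "(\<Sum>j\<in>Basis. X i * real_vector v j * of_real (G x i j)) =
        (\<Sum>j\<in>Basis. if i = j then X i * of_real (v \<bullet> i) * of_real (G x i i) else 0)"
      by (rule sum.cong) (auto simp: real_vector_def diag i)
    then show ?thesis
      using i by simp
  qed
  then show ?thesis
    by (simp add: complex_metric_def)
qed

lemma gradient_diagonal:
  fixes G :: "'a::euclidean_space metric_field"
  assumes diag: "\<forall>i\<in>Basis. \<forall>j\<in>Basis. i \<noteq> j \<longrightarrow> G x i j = 0"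
    and nz: "\<forall>i\<in>Basis. G x i i \<noteq> 0"
    and diff: "f differentiable (at x)"
  shows "gradient G f x =
    (\<lambda>i. if i \<in> Basis then frechet_derivative f (at x) i / of_real (G x i i) else 0)"
    (is "_ = ?X")
  unfolding gradient_def
proof (rule the_equality, intro conjI allI impI)
  let ?D = "frechet_derivative f (at x)"
  have lin: "linear ?D"
    using diff by (rule linear_frechet_derivative)
  show "?X i = 0" if "i \<notin> Basis" for i
    using that by simp
  show "complex_metric G x ?X (real_vector v) = ?D v" for v
  proof -
    have "?D v = ?D (\<Sum>i\<in>Basis. (v \<bullet> i) *\<^sub>R i)"
      by (simp only: euclidean_representation)
    also have "\<dots> = (\<Sum>i\<in>Basis. (v \<bullet> i) *\<^sub>R ?D i)"
      by (simp add: linear_sum[OF lin] linear_cmul[OF lin])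
    also have "\<dots> = complex_metric G x ?X (real_vector v)"
      unfolding complex_metric_real_vector_diagonal[of G x, OF diag]
      by (rule sum.cong) (auto simp: nz scaleR_conv_of_real)
    finally show ?thesis ..
  qed
  fix Y
  assume Y: "(\<forall>i. i \<notin> Basis \<longrightarrow> Y i = 0) \<and>
    (\<forall>v. complex_metric G x Y (real_vector v) = ?D v)"
  show "Y = ?X"
  proof
    fix i
    show "Y i = ?X i"
    proof (cases "i \<in> Basis")
      case True
      \<comment> \<open>Testing against the coordinate vector \<open>i\<close> isolates the component \<open>Y i\<close>.\<close>
      have "?D i = (\<Sum>j\<in>Basis. Y j * of_real (i \<bullet> j) * of_real (G x j j))"
        using Y complex_metric_real_vector_diagonal[of G x, OF diag] by metis
      also have "\<dots> = (\<Sum>j\<in>Basis. if i = j then Y i * of_real (G x i i) else 0)"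
        by (rule sum.cong) (auto simp: inner_Basis True)
      also have "\<dots> = Y i * of_real (G x i i)"
        using True by simp
      finally show ?thesis
        using True nz by simp
    qed (use Y in simp)
  qed
qed

text \<open>A permutation other than the identity picks an off-diagonal entry in its Leibniz term.\<close>

lemma gram_det_diagonal:
  fixes G :: "'a::euclidean_space metric_field"
  assumes diag: "\<forall>i\<in>Basis. \<forall>j\<in>Basis. i \<noteq> j \<longrightarrow> G x i j = 0"
  shows "gram_det G x = (\<Prod>i\<in>Basis. G x i i)"
proof -
  have off: "(\<Prod>i\<in>Basis. G x i (p i)) = 0" if p: "p permutes (Basis :: 'a set)" "p \<noteq> id" for p
  proof -
    obtain i where i: "p i \<noteq> i"
      using p(2) by (auto simp: fun_eq_iff)
    then have "i \<in> Basis"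
      using p(1) by (auto simp: permutes_def)
    then show ?thesis
      using i p(1) by (auto simp: permutes_in_image diag intro!: prod_zero bexI[of _ i])
  qed
  have "gram_det G x = (\<Sum>p\<in>{id}. of_int (sign p) * (\<Prod>i\<in>Basis. G x i (p i)))"
    unfolding gram_det_def
    by (rule sum.mono_neutral_right) (auto simp: finite_permutations permutes_id off)
  then show ?thesis
    by (simp add: sign_id)
qed

section \<open>Separated functions and their derivatives\<close>

text \<open>
  The polynomial is taken over the complex numbers, although \<open>t\<close> is real: its values then
  multiply \<open>f z + g (cnj z)\<close> without a coercion, and its derivative along the line is the
  restriction of the complex one.
\<close>

definition separated ::
    "(complex \<Rightarrow> complex) \<Rightarrow> (complex \<Rightarrow> complex) \<Rightarrow> complex poly \<Rightarrow> complex \<times> real \<Rightarrow> complex" where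
  "separated f g q = (\<lambda>(z, t). (f z + g (cnj z)) * poly q (of_real t))"

lemma has_derivative_separated:
  assumes f: "f holomorphic_on UNIV" and g: "g holomorphic_on UNIV"
  shows "(separated f g q has_derivative
    (\<lambda>v. (deriv f (fst x) * fst v + deriv g (cnj (fst x)) * cnj (fst v)) * poly q (of_real (snd x))
       + (f (fst x) + g (cnj (fst x))) * poly (pderiv q) (of_real (snd x)) * of_real (snd v)))
    (at x)"
proof -
  have "(f has_derivative (\<lambda>h. deriv f (fst x) * h)) (at (fst x))"
    using holomorphic_derivI[OF f open_UNIV, of "fst x"] by (simp add: has_field_derivative_def)
  then have 1: "((\<lambda>y. f (fst y)) has_derivative (\<lambda>v. deriv f (fst x) * fst v)) (at x)"
    by (rule has_derivative_compose[OF has_derivative_fst[OF has_derivative_ident]])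
  have "(g has_derivative (\<lambda>h. deriv g (cnj (fst x)) * h)) (at (cnj (fst x)))"
    using holomorphic_derivI[OF g open_UNIV, of "cnj (fst x)"]
    by (simp add: has_field_derivative_def)
  then have 2: "((\<lambda>y. g (cnj (fst y))) has_derivative
      (\<lambda>v. deriv g (cnj (fst x)) * cnj (fst v))) (at x)"
    by (rule has_derivative_compose[rotated]) (auto intro!: derivative_eq_intros)
  have "(poly q has_derivative (\<lambda>h. poly (pderiv q) (of_real (snd x)) * h)) (at (of_real (snd x)))"
    using poly_DERIV[of q "of_real (snd x)"] by (simp add: has_field_derivative_def)
  then have 3: "((\<lambda>y. poly q (of_real (snd y))) has_derivative
      (\<lambda>v. poly (pderiv q) (of_real (snd x)) * of_real (snd v))) (at x)"
    by (rule has_derivative_compose[rotated]) (auto intro!: derivative_eq_intros)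
  show ?thesis
    unfolding separated_def case_prod_unfold
    by (rule has_derivative_eq_rhs[OF has_derivative_mult[OF has_derivative_add[OF 1 2] 3]])
      (auto simp: algebra_simps)
qed

lemma frechet_derivative_separated:
  assumes "f holomorphic_on UNIV" and "g holomorphic_on UNIV"
  shows "frechet_derivative (separated f g q) (at x) v =
    separated (\<lambda>z. fst v * deriv f z) (\<lambda>z. cnj (fst v) * deriv g z) q x
    + separated f g (smult (of_real (snd v)) (pderiv q)) x"
  unfolding frechet_derivative_at[OF has_derivative_separated[OF assms], symmetric]
  by (simp add: separated_def case_prod_unfold algebra_simps)

lemma differentiable_separated:
  assumes "f holomorphic_on UNIV" and "g holomorphic_on UNIV"
  shows "separated f g q differentiable (at x)"
  using has_derivative_separated[OF assms] by (rule differentiableI)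

text \<open>
  The basis of the product consists of pairs with one zero component, so of the two summands in
  the derivative formula one vanishes, and each coordinate derivative is again separated.
\<close>

lemma frechet_derivative_separated_Basis:
  assumes "f holomorphic_on UNIV" and "g holomorphic_on UNIV"
  shows "frechet_derivative (separated f g q) (at x) (1, 0) = separated (deriv f) (deriv g) q x"
    and "frechet_derivative (separated f g q) (at x) (\<i>, 0) =
      separated (\<lambda>z. \<i> * deriv f z) (\<lambda>z. - \<i> * deriv g z) q x"
    and "frechet_derivative (separated f g q) (at x) (0, 1) = separated f g (pderiv q) x"
  by (simp_all add: frechet_derivative_separated[OF assms])
    (simp_all add: separated_def case_prod_unfold)

lemma Basis_complex_real:
  "(Basis :: (complex \<times> real) set) = {(1, 0), (\<i>, 0), (0, 1)}"
  by (auto simp: Basis_prod_def Basis_complex_def)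

lemma cont_diff_separated:
  assumes "f holomorphic_on UNIV" and "g holomorphic_on UNIV"
  shows "cont_diff k (separated f g q)"
  using assms
proof (induction k arbitrary: f g q)
  case 0
  then have "separated f g q differentiable_on UNIV"
    by (simp add: differentiable_on_def differentiable_separated)
  then show ?case
    by (simp add: differentiable_imp_continuous_on)
next
  case (Suc k)
  have hol: "deriv f holomorphic_on UNIV" "deriv g holomorphic_on UNIV"
    using Suc.prems by (auto intro: holomorphic_deriv)
  then have "(\<lambda>z. \<i> * deriv f z) holomorphic_on UNIV" "(\<lambda>z. - \<i> * deriv g z) holomorphic_on UNIV"
    by (auto intro!: holomorphic_intros)
  then show ?case
    using Suc hol
    by (simp add: differentiable_on_def differentiable_separated Basis_complex_real
        frechet_derivative_separated_Basis)
qed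

lemma smooth_separated:
  assumes "f holomorphic_on UNIV" and "g holomorphic_on UNIV"
  shows "smooth (separated f g q)"
  by (simp add: smooth_def cont_diff_separated assms)

section \<open>The Laplace-Beltrami operator of the product\<close>

abbreviation sphere_line_metric :: "(complex \<times> real) metric_field" where
  "sphere_line_metric \<equiv> product_metric punctured_sphere_metric line_metric"

definition conformal_factor :: "complex \<Rightarrow> real" where
  "conformal_factor z = 4 / (1 + ((Re z)\<^sup>2 + (Im z)\<^sup>2))\<^sup>2"

lemma conformal_factor_pos: "conformal_factor z > 0"
  unfolding conformal_factor_def
  by (intro divide_pos_pos zero_less_power add_pos_nonneg) auto

lemma sphere_line_metric_eq:
  "sphere_line_metric x u v =
    conformal_factor (fst x) * (Re (fst u) * Re (fst v) + Im (fst u) * Im (fst v)) + snd u * snd v"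
  by (simp add: product_metric_def punctured_sphere_metric_def line_metric_def conformal_factor_def)

lemma sphere_line_metric_off_diagonal:
  "\<forall>i\<in>Basis. \<forall>j\<in>Basis. i \<noteq> j \<longrightarrow> sphere_line_metric x i j = 0"
  by (auto simp: sphere_line_metric_eq Basis_complex_real)

lemma sphere_line_metric_diagonal_nonzero:
  "\<forall>i\<in>Basis. sphere_line_metric x i i \<noteq> 0"
  using conformal_factor_pos[of "fst x"] by (auto simp: sphere_line_metric_eq Basis_complex_real)

lemma sqrt_gram_det_sphere_line:
  "sqrt (gram_det sphere_line_metric x) = conformal_factor (fst x)"
proof -
  have "gram_det sphere_line_metric x = (conformal_factor (fst x))\<^sup>2"
    by (simp add: gram_det_diagonal sphere_line_metric_off_diagonal
        Basis_complex_real sphere_line_metric_eq power2_eq_square)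
  then show ?thesis
    using conformal_factor_pos[of "fst x"] by simp
qed

lemma differentiable_conformal_factor: "conformal_factor differentiable (at z)"
proof -
  have "1 + ((Re z)\<^sup>2 + (Im z)\<^sup>2) \<noteq> 0"
    using sum_power2_ge_zero[of "Re z" "Im z"] by linarith
  moreover have "Re differentiable (at z)" "Im differentiable (at z)"
    by (auto intro: bounded_linear_imp_differentiable bounded_linear_Re bounded_linear_Im)
  ultimately show ?thesis
    unfolding conformal_factor_def[abs_def]
    by (intro derivative_intros) auto
qed

text \<open>
  The volume density depends only on the sphere coordinate, so differentiation along the line
  treats it as a constant.
\<close>

lemma frechet_derivative_conformal_factor_line:
  fixes F :: "complex \<times> real \<Rightarrow> complex"
  assumes F: "F differentiable (at x)"
  shows "frechet_derivative (\<lambda>y. of_real (conformal_factor (fst y)) * F y) (at x) (0, 1) =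
    of_real (conformal_factor (fst x)) * frechet_derivative F (at x) (0, 1)"
proof -
  obtain C where C: "(conformal_factor has_derivative C) (at (fst x))"
    using differentiable_conformal_factor by (auto simp: differentiable_def)
  have C0: "C 0 = 0"
    using C by (simp add: has_derivative_bounded_linear linear_0 bounded_linear.linear)
  have "((\<lambda>y. conformal_factor (fst y)) has_derivative (\<lambda>v. C (fst v))) (at x)"
    using C by (rule has_derivative_compose[OF has_derivative_fst[OF has_derivative_ident]])
  then have "((\<lambda>y. of_real (conformal_factor (fst y)) :: complex) has_derivative
      (\<lambda>v. of_real (C (fst v)))) (at x)"
    by (rule has_derivative_of_real)
  from has_derivative_mult[OF this F[unfolded frechet_derivative_works]]
  have "frechet_derivative (\<lambda>y. of_real (conformal_factor (fst y)) * F y) (at x) =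
      (\<lambda>v. of_real (conformal_factor (fst x)) * frechet_derivative F (at x) v
         + of_real (C (fst v)) * F x)"
    by (rule frechet_derivative_at[symmetric])
  then show ?thesis
    by (simp add: C0)
qed

lemma laplace_beltrami_separated:
  assumes f: "f holomorphic_on UNIV" and g: "g holomorphic_on UNIV"
  shows "laplace_beltrami sphere_line_metric (separated f g q) =
    separated f g (pderiv (pderiv q))"
proof
  fix x :: "complex \<times> real"
  let ?F = "separated f g q"
  let ?c = "\<lambda>y :: complex \<times> real. complex_of_real (conformal_factor (fst y))"
  have c: "conformal_factor z \<noteq> 0" for z
    using conformal_factor_pos[of z] by simp
  have grad: "gradient sphere_line_metric ?F y = (\<lambda>i. if i \<in> Basis
      then frechet_derivative ?F (at y) i / of_real (sphere_line_metric y i i) else 0)" for y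
    by (intro gradient_diagonal sphere_line_metric_off_diagonal
        sphere_line_metric_diagonal_nonzero differentiable_separated f g)
  \<comment> \<open>The density \<open>?c\<close> times the inverse metric coefficient is 1 in both sphere directions
    and \<open>?c\<close> along the line.\<close>
  have 1: "(\<lambda>y. ?c y * gradient sphere_line_metric ?F y (1, 0)) = separated (deriv f) (deriv g) q"
    by (rule ext) (simp add: grad Basis_complex_real sphere_line_metric_eq c
        frechet_derivative_separated_Basis f g)
  have 2: "(\<lambda>y. ?c y * gradient sphere_line_metric ?F y (\<i>, 0)) =
      separated (\<lambda>z. \<i> * deriv f z) (\<lambda>z. - \<i> * deriv g z) q"
    by (rule ext) (simp add: grad Basis_complex_real sphere_line_metric_eq c
        frechet_derivative_separated_Basis f g)
  have 3: "(\<lambda>y. ?c y * gradient sphere_line_metric ?F y (0, 1)) =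
      (\<lambda>y. ?c y * separated f g (pderiv q) y)"
    by (rule ext) (simp add: grad Basis_complex_real sphere_line_metric_eq c
        frechet_derivative_separated_Basis f g)
  have hol: "deriv f holomorphic_on UNIV" "deriv g holomorphic_on UNIV"
    using f g by (auto intro: holomorphic_deriv)
  then have hol': "(\<lambda>z. \<i> * deriv f z) holomorphic_on UNIV"
      "(\<lambda>z. - \<i> * deriv g z) holomorphic_on UNIV"
    by (auto intro!: holomorphic_intros)
  have rot: "deriv (\<lambda>z. a * deriv h z) z = a * deriv (deriv h) z"
    if "deriv h holomorphic_on UNIV" for a z and h :: "complex \<Rightarrow> complex"
    using that by (intro deriv_cmult holomorphic_on_imp_differentiable_at[OF _ open_UNIV]) auto
  \<comment> \<open>The second derivatives along the real and imaginary directions cancel because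
    \<open>\<i>\<^sup>2 = (- \<i>)\<^sup>2 = -1\<close>: this is harmonicity of \<open>f z + g (cnj z)\<close>.\<close>
  have cancel: "separated (deriv (deriv f)) (deriv (deriv g)) q x
      + separated (\<lambda>z. \<i> * deriv (\<lambda>z. \<i> * deriv f z) z) (\<lambda>z. - \<i> * deriv (\<lambda>z. - \<i> * deriv g z) z) q x
      = 0"
    by (simp only: rot hol) (simp add: separated_def case_prod_unfold algebra_simps)
  have "laplace_beltrami sphere_line_metric ?F x =
      (frechet_derivative (separated (deriv f) (deriv g) q) (at x) (1, 0)
      + (frechet_derivative (separated (\<lambda>z. \<i> * deriv f z) (\<lambda>z. - \<i> * deriv g z) q) (at x) (\<i>, 0)
      + frechet_derivative (\<lambda>y. ?c y * separated f g (pderiv q) y) (at x) (0, 1))) / ?c x"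
    by (simp add: laplace_beltrami_def divergence_def sqrt_gram_det_sphere_line Basis_complex_real
        1[simplified] 2[simplified] 3[simplified])
  also have "\<dots> = frechet_derivative (\<lambda>y. ?c y * separated f g (pderiv q) y) (at x) (0, 1) / ?c x"
    unfolding frechet_derivative_separated_Basis[OF hol] frechet_derivative_separated_Basis[OF hol']
      add.assoc[symmetric] cancel by simp
  also have "\<dots> = separated f g (pderiv (pderiv q)) x"
    by (simp add: frechet_derivative_conformal_factor_line differentiable_separated f g
        frechet_derivative_separated_Basis c)
  finally show "laplace_beltrami sphere_line_metric (separated f g q) x =
      separated f g (pderiv (pderiv q)) x" .
qed

section \<open>Proper biharmonicity\<close>

theorem corollary7p3:
  fixes f g :: "complex \<Rightarrow> complex" and b0 b1 b2 b3 :: real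
  assumes "f holomorphic_on UNIV" and "g holomorphic_on UNIV"
    and "(b2, b3) \<noteq> (0, 0)"
    and "\<exists>z. f z + g (cnj z) \<noteq> 0"
  shows "proper_biharmonic (product_metric punctured_sphere_metric line_metric)
    (\<lambda>(z, t). (f z + g (cnj z)) * of_real (b0 + b1 * t + b2 * t ^ 2 + b3 * t ^ 3))"
proof -
  define q :: "complex poly" where "q = [:of_real b0, of_real b1, of_real b2, of_real b3:]"
  have F: "(\<lambda>(z, t). (f z + g (cnj z)) * of_real (b0 + b1 * t + b2 * t ^ 2 + b3 * t ^ 3)) =
      separated f g q"
    by (auto simp: separated_def q_def algebra_simps power2_eq_square power3_eq_cube)
  have q2: "pderiv (pderiv q) = [:of_real (2 * b2), of_real (6 * b3):]"
    by (simp add: q_def pderiv_pCons)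
  have q4: "pderiv (pderiv (pderiv (pderiv q))) = 0"
    by (simp add: q2 pderiv_pCons)
  obtain z where z: "f z + g (cnj z) \<noteq> 0"
    using assms(4) by blast
  \<comment> \<open>A nonzero polynomial of degree at most 1 cannot vanish at both 0 and 1.\<close>
  have "\<exists>t::real. poly (pderiv (pderiv q)) (of_real t) \<noteq> 0"
  proof (cases "b2 = 0")
    case True
    then show ?thesis
      using assms(3) by (intro exI[of _ 1]) (simp add: q2)
  next
    case False
    then show ?thesis
      by (intro exI[of _ 0]) (simp add: q2)
  qed
  then obtain t :: real where t: "poly (pderiv (pderiv q)) (of_real t) \<noteq> 0"
    by blast
  have "separated f g (pderiv (pderiv q)) (z, t) \<noteq> 0"
    using z t by (simp add: separated_def)
  moreover have "separated f g 0 = (\<lambda>x. 0)"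
    by (auto simp: separated_def)
  ultimately show ?thesis
    unfolding F proper_biharmonic_def
    using smooth_separated[OF assms(1,2)]
    by (auto simp: laplace_beltrami_separated assms(1,2) q4)
qed

end
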